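(* Let $N\ge 2$, $M\ge 1$ be integers, let $\varepsilon\ge 0$, and let $x\neq x'$ be two response values. Suppose $N$ users, including two particular distinct users Alice and Bob, take part in the $M$-round protocol described in the context with an $\varepsilon$-sender-anonymous service. Then for every adversary, the probability $p_{\mathrm{decep}}$ that after $M$ rounds Alice accepts the value $x$ and Bob accepts the value $x'$ satisfies $$p_{\mathrm{decep}}\le \frac{\left[\frac N2\right]^M\left(N-\left[\frac N2\right]\right)^M}{N^M(N-1)^M}(1+\varepsilon)^M .$$
   Context: Notation: $\mathbb Z_N=\{0,\dots,N-1\}$; $\mathrm{Bij}(A\to B)$ is the set of bijections from $A$ to $B$; $[N/2]$ denotes $N/2$ rounded to an integer (for odd $N$ in either direction; the product $[N/2](N-[N/2])$ is the same). Anonymized access. Let $\mathcal U$ be the set of $N$ users. A leakage map $\mathcal L$ is a fixed, possibly randomized, map taking each bijection $\mathcal U\to\mathbb Z_N$ to leaked information in a countable set (if randomized, it uses fresh independent randomness at every use). In one round of anonymous requests, all $N$ users make identical simultaneous requests: a bijection $R_I$ is drawn uniformly from $\mathrm{Bij}(\mathcal U\to\mathbb Z_N)$, independently of all previous rounds; the adversary (the possibly malicious service, arbitrary, stateful and possibly randomized) is given $\mathcal L(R_I)$ and outputs a response function $R_V:\mathbb Z_N\to\{0,1\}^*$; user $u$ receives $R_V(R_I(u))$. After the round, $(R_I,R_V)$ is appended to the adversary's state, so later behaviour may depend on it. Sender anonymity. Experiment $\mathrm{EXP\text{-}SA}_{\mathcal L,\mathcal U,M}(\mathcal A)$: run $M-1$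 rounds of anonymous requests (in each, a bijection is drawn uniformly from $\mathrm{Bij}(\mathcal U\to\mathbb Z_N)$ independently of all previous rounds, the adversary $\mathcal A$ is given the leakage of that bijection and outputs a response function, and the bijection and response function are then appended to its state), then an $M$-th round of anonymous requests with mapping $R_I$, drawn in the same way; then the adversary $\mathcal A$, knowing $\mathcal U$, $\mathcal L$, its state (from the first $M-1$ rounds) and the leakage of the $M$-th round, outputs a guess $\hat R\in\mathrm{Bij}(\mathcal U\to\mathbb Z_N)$. The experiment returns $1$ if $\hat R=R_I$ and $0$ otherwise. The service with its anonymizer is $\varepsilon$-sender-anonymous ($\varepsilon\ge0$) if for all adversaries $\mathcal A$, $\Pr[\mathrm{EXP\text{-}SA}_{\mathcal L,\mathcal U,M}(\mathcal A)=1]\le\frac{1}{N!}(1+\varepsilon)$. Protocol: the $N$ users perform $M$ rounds of anonymous requests. A user accepts the value $v$ if all $M$ responses it receives equal $v$; a user whose $M$ responses are not all identical signals an error and accepts nothing. *)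

theory Defs
  imports "HOL-Probability.Probability" "HOL-Library.Monad_Syntax"
begin

text \<open>
  The set \<open>\<int>\<^sub>N\<close> is \<open>{..<N}\<close> with \<open>N = card U\<close>. Maps between sets are extensional functions, so that
  there are exactly as many of them as in set-theoretic mathematics and uniform distributions on
  them make sense.
\<close>

definition Bij :: "'u set \<Rightarrow> ('u \<Rightarrow> nat) set" where
  "Bij U = {R \<in> U \<rightarrow>\<^sub>E {..<card U}. bij_betw R U {..<card U}}"

lemma finite_Bij: "finite U \<Longrightarrow> finite (Bij U)"
  by (simp add: Bij_def finite_PiE)

lemma Bij_nonempty:
  assumes "finite U"
  shows "Bij U \<noteq> {}"
proof -
  obtain h where h: "bij_betw h U {..<card U}"
    using assms ex_bij_betw_finite_nat[OF assms] by (auto simp: atLeast0LessThan)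
  from h have "restrict h U \<in> Bij U"
    using bij_betw_apply[OF h] by (simp add: Bij_def)
  then show ?thesis
    by blast
qed

type_synonym response = "nat \<Rightarrow> bool list"

definition responses :: "'u set \<Rightarrow> response set" where
  "responses U = {..<card U} \<rightarrow>\<^sub>E UNIV"

text \<open>
  A leakage map sends a bijection to the distribution of the leaked information; it is sampled
  afresh at every use.
\<close>

type_synonym ('u, 'l) leakage = "('u \<Rightarrow> nat) \<Rightarrow> 'l pmf"

text \<open>
  The state of the adversary consists of a private memory, which is an arbitrary bit string under its
  control (it can hold, e.g., encodings of all leakages seen and of all coins tossed so far), and of
  the list of the pairs \<open>(R\<^sub>I, R\<^sub>V)\<close> appended after the completed rounds, oldest first.
\<close>

type_synonym 'u record_list = "(('u \<Rightarrow> nat) \<times> response) list"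
type_synonym 'u state = "bool list \<times> 'u record_list"

text \<open>
  In a round the adversary maps its state and the current leakage to a random response function
  together with its new private memory.
\<close>

type_synonym ('u, 'l) adversary = "'u state \<Rightarrow> 'l \<Rightarrow> (response \<times> bool list) pmf"

type_synonym ('u, 'l) guesser = "'u state \<Rightarrow> 'l \<Rightarrow> ('u \<Rightarrow> nat) pmf"

definition is_adversary :: "'u set \<Rightarrow> ('u, 'l) adversary \<Rightarrow> bool" where
  "is_adversary U A \<longleftrightarrow> (\<forall>s l. set_pmf (A s l) \<subseteq> responses U \<times> UNIV)"

definition is_guesser :: "'u set \<Rightarrow> ('u, 'l) guesser \<Rightarrow> bool" where
  "is_guesser U G \<longleftrightarrow> (\<forall>s l. set_pmf (G s l) \<subseteq> Bij U)"

definition anonymous_round ::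
  "('u, 'l) leakage \<Rightarrow> 'u set \<Rightarrow> ('u, 'l) adversary \<Rightarrow> 'u state
    \<Rightarrow> (('u \<Rightarrow> nat) \<times> 'l \<times> response \<times> bool list) pmf" where
  "anonymous_round L U A s = do {
     R\<^sub>I \<leftarrow> pmf_of_set (Bij U);
     l \<leftarrow> L R\<^sub>I;
     (R\<^sub>V, mem) \<leftarrow> A s l;
     return_pmf (R\<^sub>I, l, R\<^sub>V, mem)
   }"

primrec run_rounds ::
  "('u, 'l) leakage \<Rightarrow> 'u set \<Rightarrow> ('u, 'l) adversary \<Rightarrow> nat \<Rightarrow> 'u state pmf" where
  "run_rounds L U A 0 = return_pmf ([], [])"
| "run_rounds L U A (Suc m) = do {
     s \<leftarrow> run_rounds L U A m;
     (R\<^sub>I, l, R\<^sub>V, mem) \<leftarrow> anonymous_round L U A s;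
     return_pmf (mem, snd s @ [(R\<^sub>I, R\<^sub>V)])
   }"

text \<open>
  In the sender anonymity experiment an adversary is a pair of a response strategy \<open>A\<close> and a guessing
  strategy \<open>G\<close>; the guess depends on the state before the last round and on the last leakage.
\<close>

definition exp_SA ::
  "('u, 'l) leakage \<Rightarrow> 'u set \<Rightarrow> nat \<Rightarrow> ('u, 'l) adversary \<Rightarrow> ('u, 'l) guesser \<Rightarrow> bool pmf" where
  "exp_SA L U M A G = do {
     s \<leftarrow> run_rounds L U A (M - 1);
     (R\<^sub>I, l, R\<^sub>V, mem) \<leftarrow> anonymous_round L U A s;
     R' \<leftarrow> G s l;
     return_pmf (R' = R\<^sub>I)
   }"

definition sender_anonymous :: "('u, 'l) leakage \<Rightarrow> 'u set \<Rightarrow> nat \<Rightarrow> real \<Rightarrow> bool" where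
  "sender_anonymous L U M \<epsilon> \<longleftrightarrow>
     (\<forall>A G. is_adversary U A \<longrightarrow> is_guesser U G \<longrightarrow>
        pmf (exp_SA L U M A G) True \<le> 1 / fact (card U) * (1 + \<epsilon>))"

definition received :: "'u \<Rightarrow> 'u record_list \<Rightarrow> bool list list" where
  "received u rs = map (\<lambda>(R\<^sub>I, R\<^sub>V). R\<^sub>V (R\<^sub>I u)) rs"

text \<open>The outcome \<open>None\<close> means that the user signals an error and accepts nothing.\<close>

fun accepted :: "bool list list \<Rightarrow> bool list option" where
  "accepted [] = None"
| "accepted (v # vs) = (if \<forall>w \<in> set vs. w = v then Some v else None)"

definition p_decep ::
  "('u, 'l) leakage \<Rightarrow> 'u set \<Rightarrow> nat \<Rightarrow> ('u, 'l) adversary \<Rightarrow> 'u \<Rightarrow> 'u \<Rightarrow> bool list \<Rightarrow> bool list \<Rightarrow> real"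
where
  "p_decep L U M A alice bob x x' =
     measure_pmf.prob (run_rounds L U A M)
       {(mem, rs). accepted (received alice rs) = Some x \<and> accepted (received bob rs) = Some x'}"

end

theory Submission
  imports Defs
begin

text \<open>
  Since the bijection of a round is independent of the state, guessing a bijection of maximal
  likelihood given the leakage \<open>l\<close> succeeds with probability
  \<open>(\<Sum>l. max\<^sub>R Pr[l | R]) / card (Bij U)\<close>, whatever happened before, so \<open>\<epsilon>\<close>-sender-anonymity bounds
  this number by \<open>(1 + \<epsilon>) / N!\<close>. In any single round, replacing \<open>Pr[l | R]\<close> by its maximum over
  \<open>R\<close> leaves for every response function only the number of bijections that deceive Alice and Bob to
  be counted. If the values \<open>x\<close> and \<open>x'\<close> are placed at \<open>p\<close> and \<open>q\<close> positions, there are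
  \<open>p q (N - 2)!\<close> such bijections, and \<open>p + q \<le> N\<close>. Hence every round succeeds with
  probability at most \<open>[N/2] (N - [N/2]) (1 + \<epsilon>) / (N (N - 1))\<close> conditionally on the past.
\<close>

text \<open>By symmetry take \<open>p \<le> q\<close>, so \<open>p \<le> n div 2\<close>. Raising
  \<open>p\<close> by \<open>d\<close> to \<open>n div 2\<close> lowers the other factor by at most
  \<open>d\<close>, and \<open>p * d \<le> d * e\<close> because \<open>p\<close> is at most the
  larger half \<open>e\<close>.\<close>

lemma mult_le_half_mult_half:
  fixes p q n :: nat
  assumes "p + q \<le> n"
  shows "p * q \<le> (n div 2) * (n - n div 2)"
proof -
  have aux: "p * q \<le> (n div 2) * (n - n div 2)" if "p \<le> q" "p + q \<le> n" for p q :: nat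
  proof -
    have "p \<le> n div 2"
      using that by linarith
    then obtain d where d: "n div 2 = p + d"
      using le_Suc_ex by blast
    define e where "e = n - n div 2"
    have e: "n div 2 \<le> e" "q \<le> e + d"
      using that d unfolding e_def by linarith+
    have "p * q \<le> p * (e + d)"
      using e by simp
    also have "\<dots> \<le> p * e + d * e"
      using e d by (simp add: algebra_simps mult_le_mono)
    finally show ?thesis
      unfolding e_def[symmetric] unfolding d by (simp add: algebra_simps)
  qed
  show ?thesis
    using aux[of p q] aux[of q p] assms by (cases "p \<le> q") (auto simp: mult.commute)
qed

lemma card_inj_extensional_funcset:
  assumes "finite A" "finite B" "card A = card B"
  shows "card {f \<in> A \<rightarrow>\<^sub>E B. inj_on f A} = fact (card A)"
  using card_inj_on_subset_funcset[of A B A] assms by (simp add: fact_prod_rev)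

text \<open>Such a bijection is determined by its restriction to the other users, which is an
  injection into the \<open>card U - 2\<close> remaining positions.\<close>

lemma card_Bij_fix_two_le:
  assumes "finite U" "a \<in> U" "b \<in> U" "a \<noteq> b"
    and "i < card U" "j < card U" "i \<noteq> j"
  shows "card {R \<in> Bij U. R a = i \<and> R b = j} \<le> fact (card U - 2)"
proof -
  let ?S = "{R \<in> Bij U. R a = i \<and> R b = j}"
  let ?V = "U - {a, b}" and ?W = "{..<card U} - {i, j}"
  let ?F = "{f \<in> ?V \<rightarrow>\<^sub>E ?W. inj_on f ?V}"
  have card: "card ?V = card U - 2" "card ?W = card U - 2"
    using assms by (simp_all add: card_Diff_subset)
  have "inj_on (\<lambda>R. restrict R ?V) ?S"
  proof (rule inj_onI)
    fix R R'
    assume R: "R \<in> ?S" "R' \<in> ?S" and eq: "restrict R ?V = restrict R' ?V"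
    have "R u = R' u" for u
    proof (cases "u \<in> ?V")
      case True
      then show ?thesis using fun_cong[OF eq, of u] by simp
    next
      case False
      \<comment> \<open>At \<open>a\<close> and \<open>b\<close> the values are prescribed; outside
        \<open>U\<close> extensionality makes both maps \<open>undefined\<close>.\<close>
      then have "u = a \<or> u = b \<or> u \<notin> U" by auto
      then show ?thesis using R by (auto simp: Bij_def PiE_def extensional_def)
    qed
    then show "R = R'" by auto
  qed
  moreover have "(\<lambda>R. restrict R ?V) ` ?S \<subseteq> ?F"
  proof (rule image_subsetI)
    fix R
    assume "R \<in> ?S"
    then have R: "R \<in> Bij U" and ij: "i = R a" "j = R b" by auto
    have inj: "inj_on R U" and ran: "\<And>u. u \<in> U \<Longrightarrow> R u < card U"
      using R by (auto simp: Bij_def bij_betw_def)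
    have "restrict R ?V \<in> ?V \<rightarrow>\<^sub>E ?W"
      using ran inj assms(2,3) by (auto simp: ij dest: inj_onD)
    moreover have "inj_on (restrict R ?V) ?V"
      using inj by (auto simp: inj_on_def)
    ultimately show "restrict R ?V \<in> ?F" by simp
  qed
  moreover have "finite ?F"
    using assms(1) by (simp add: finite_PiE)
  ultimately have "card ?S \<le> card ?F"
    by (rule card_inj_on_le)
  also have "\<dots> = fact (card U - 2)"
    using card_inj_extensional_funcset[of ?V ?W] card assms(1) by simp
  finally show ?thesis .
qed

text \<open>Success within a single round. Acceptance by both users forces it in every round, so a
  bound per round suffices.\<close>

definition deceiving :: "'u \<Rightarrow> 'u \<Rightarrow> 'b \<Rightarrow> 'b \<Rightarrow> ('u \<Rightarrow> nat) \<Rightarrow> (nat \<Rightarrow> 'b) \<Rightarrow> bool" where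
  "deceiving a b x y R v \<longleftrightarrow> v (R a) = x \<and> v (R b) = y"

text \<open>As \<open>x \<noteq> y\<close>, the positions carrying \<open>x\<close> and those
  carrying \<open>y\<close> are disjoint, so their numbers add up to at most \<open>card U\<close>.
  Each pair of such positions contributes at most \<open>fact (card U - 2)\<close>
  bijections.\<close>

lemma card_deceiving_le:
  assumes "finite U" "a \<in> U" "b \<in> U" "a \<noteq> b" "x \<noteq> y"
  shows "card {R \<in> Bij U. deceiving a b x y R v}
    \<le> (card U div 2) * (card U - card U div 2) * fact (card U - 2)"
proof -
  define X Y where "X = {i. i < card U \<and> v i = x}" and "Y = {i. i < card U \<and> v i = y}"
  have fin: "finite X" "finite Y" and disj: "X \<inter> Y = {}"
    using assms(5) by (auto simp: X_def Y_def)
  have "card X + card Y = card (X \<union> Y)"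
    using fin disj by (simp add: card_Un_disjoint)
  also have "\<dots> \<le> card {..<card U}"
    by (rule card_mono) (auto simp: X_def Y_def)
  finally have XY: "card X * card Y \<le> (card U div 2) * (card U - card U div 2)"
    by (intro mult_le_half_mult_half) simp
  have "{R \<in> Bij U. deceiving a b x y R v}
      \<subseteq> (\<Union>(i, j) \<in> X \<times> Y. {R \<in> Bij U. R a = i \<and> R b = j})"
    using assms(2,3) by (auto simp: Bij_def deceiving_def X_def Y_def)
  then have "card {R \<in> Bij U. deceiving a b x y R v}
      \<le> card (\<Union>(i, j) \<in> X \<times> Y. {R \<in> Bij U. R a = i \<and> R b = j})"
    by (intro card_mono) (auto simp: fin finite_Bij assms(1))
  also have "\<dots> \<le> (\<Sum>(i, j) \<in> X \<times> Y. card {R \<in> Bij U. R a = i \<and> R b = j})"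
    using card_UN_le[of "X \<times> Y" "\<lambda>(i, j). {R \<in> Bij U. R a = i \<and> R b = j}"] fin
    by (simp add: case_prod_unfold)
  also have "\<dots> \<le> (\<Sum>(i, j) \<in> X \<times> Y. fact (card U - 2))"
    using assms disj
    by (intro sum_mono) (auto simp: X_def Y_def intro!: card_Bij_fix_two_le)
  also have "\<dots> = card X * card Y * fact (card U - 2)"
    by (simp add: case_prod_unfold card_cartesian_product)
  also have "\<dots> \<le> (card U div 2) * (card U - card U div 2) * fact (card U - 2)"
    using XY by (rule mult_le_mono1)
  finally show ?thesis .
qed

text \<open>For \<open>R\<close> uniform on a finite nonempty \<open>B\<close>, the sum of this over
  \<open>l\<close>, divided by \<open>card B\<close>, is the success probability of the best guess
  of \<open>R\<close> from \<open>l\<close>.\<close>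

definition max_likelihood :: "('r \<Rightarrow> 'l pmf) \<Rightarrow> 'r set \<Rightarrow> 'l \<Rightarrow> real" where
  "max_likelihood L B l = Max ((\<lambda>R. pmf (L R) l) ` B)"

lemma pmf_le_max_likelihood:
  assumes "finite B" "R \<in> B"
  shows "pmf (L R) l \<le> max_likelihood L B l"
  unfolding max_likelihood_def using assms by (intro Max_ge) auto

lemma max_likelihood_attained:
  assumes "finite B" "B \<noteq> {}"
  obtains R where "R \<in> B" "max_likelihood L B l = pmf (L R) l"
proof -
  have "max_likelihood L B l \<in> (\<lambda>R. pmf (L R) l) ` B"
    unfolding max_likelihood_def using assms by (intro Max_in) auto
  then show ?thesis
    using that by auto
qed

text \<open>With the sum over leakages outside, all \<open>R\<close> can be compared for one leakage
  at a time.\<close>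

lemma nn_integral_pmf_of_set_channel:
  assumes "finite B" "B \<noteq> {}"
  shows "(\<integral>\<^sup>+R. \<integral>\<^sup>+l. f R l \<partial>measure_pmf (L R) \<partial>measure_pmf (pmf_of_set B))
    = (\<integral>\<^sup>+l. (\<Sum>R\<in>B. ennreal (pmf (L R) l) * f R l) \<partial>count_space UNIV) / of_nat (card B)"
proof -
  have "(\<Sum>R\<in>B. \<integral>\<^sup>+l. f R l \<partial>measure_pmf (L R))
      = (\<integral>\<^sup>+l. (\<Sum>R\<in>B. ennreal (pmf (L R) l) * f R l) \<partial>count_space UNIV)"
    by (simp add: nn_integral_measure_pmf nn_integral_sum)
  then show ?thesis
    using assms by (simp add: nn_integral_pmf_of_set)
qed

lemma nn_integral_anonymous_round:
  assumes "finite U"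
  shows "(\<integral>\<^sup>+z. h z \<partial>measure_pmf (anonymous_round L U A s))
    = (\<integral>\<^sup>+l. (\<Sum>R\<in>Bij U. ennreal (pmf (L R) l) * (\<integral>\<^sup>+w. h (R, l, w) \<partial>measure_pmf (A s l)))
        \<partial>count_space UNIV) / of_nat (card (Bij U))"
  using assms
  by (simp add: anonymous_round_def case_prod_unfold
      nn_integral_pmf_of_set_channel[OF finite_Bij Bij_nonempty])

text \<open>The left-hand side is exactly the success probability of the guesser that ignores the
  state and returns a maximizer \<open>g l\<close> of the likelihood.\<close>

lemma sender_anonymous_imp_max_likelihood_le:
  fixes L :: "('u, 'l) leakage" and A :: "('u, 'l) adversary"
  assumes "finite U" "sender_anonymous L U M \<epsilon>" "is_adversary U A"
  shows "(\<integral>\<^sup>+l. ennreal (max_likelihood L (Bij U) l) \<partial>count_space UNIV) / of_nat (card (Bij U))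
    \<le> ennreal (1 / fact (card U) * (1 + \<epsilon>))"
proof -
  have "\<exists>R. R \<in> Bij U \<and> max_likelihood L (Bij U) l = pmf (L R) l" for l
    using max_likelihood_attained[OF finite_Bij Bij_nonempty] assms(1) by metis
  then obtain g where g: "\<And>l. g l \<in> Bij U"
      "\<And>l. max_likelihood L (Bij U) l = pmf (L (g l)) l"
    by metis
  define G :: "('u, 'l) guesser" where "G = (\<lambda>s l. return_pmf (g l))"
  have "is_guesser U G"
    using g by (auto simp: is_guesser_def G_def)
  then have "pmf (exp_SA L U M A G) True \<le> 1 / fact (card U) * (1 + \<epsilon>)"
    using assms unfolding sender_anonymous_def by blast
  moreover have "ennreal (pmf (exp_SA L U M A G) True)
      = (\<integral>\<^sup>+l. ennreal (max_likelihood L (Bij U) l) \<partial>count_space UNIV) / of_nat (card (Bij U))"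
  proof -
    \<comment> \<open>Only the term \<open>R = g l\<close> survives, and its likelihood is the
      maximum.\<close>
    have "(\<Sum>R\<in>Bij U. ennreal (pmf (L R) l) * indicator {True} (g l = R))
        = ennreal (max_likelihood L (Bij U) l)" for l
    proof -
      have "(\<Sum>R\<in>Bij U. ennreal (pmf (L R) l) * indicator {True} (g l = R))
          = (\<Sum>R\<in>Bij U. if g l = R then ennreal (pmf (L R) l) else 0)"
        by (intro sum.cong) auto
      also have "\<dots> = ennreal (max_likelihood L (Bij U) l)"
        using g assms(1) by (simp add: finite_Bij)
      finally show ?thesis .
    qed
    \<comment> \<open>The conditional success probability is the same for every state, so averaging
      over the earlier rounds leaves it unchanged.\<close>
    then show ?thesis
      using assms(1)
      by (simp add: emeasure_pmf_single[symmetric] exp_SA_def G_def case_prod_unfold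
          nn_integral_anonymous_round)
  qed
  ultimately show ?thesis
    by (metis ennreal_leI)
qed

text \<open>The bound is uniform in the state \<open>s\<close>, because the fresh bijection does not
  depend on it; this is what lets the rounds be multiplied.\<close>

lemma emeasure_anonymous_round_deceiving_le:
  fixes L :: "('u, 'l) leakage" and A :: "('u, 'l) adversary"
  assumes "finite U" "a \<in> U" "b \<in> U" "a \<noteq> b" "x \<noteq> y"
    and "sender_anonymous L U M \<epsilon>" "is_adversary U A"
  shows "emeasure (anonymous_round L U A s) {(R, l, v, mem). deceiving a b x y R v}
    \<le> of_nat ((card U div 2) * (card U - card U div 2) * fact (card U - 2))
        * ennreal (1 / fact (card U) * (1 + \<epsilon>))"
proof -
  define K :: nat where "K = (card U div 2) * (card U - card U div 2) * fact (card U - 2)"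
  let ?c = "max_likelihood L (Bij U)"
  let ?E = "{(R, l, v, mem). deceiving a b x y R v}"
  have fin: "finite (Bij U)"
    using assms(1) by (rule finite_Bij)
  have sum_le: "(\<Sum>R\<in>Bij U. ennreal (pmf (L R) l) * (\<integral>\<^sup>+w. indicator ?E (R, l, w) \<partial>A s l))
      \<le> of_nat K * ennreal (?c l)" (is "?S \<le> _") for l
  proof -
    \<comment> \<open>The maximum no longer depends on \<open>R\<close> and comes out of the sum.
      Since \<open>w\<close> is drawn from \<open>s\<close> and \<open>l\<close> alone, sum and
      integral swap, and for each \<open>w\<close> only the number of deceiving bijections
      remains.\<close>
    have "?S \<le> (\<Sum>R\<in>Bij U. ennreal (?c l) * (\<integral>\<^sup>+w. indicator ?E (R, l, w) \<partial>A s l))"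
      by (intro sum_mono mult_right_mono ennreal_leI pmf_le_max_likelihood fin) auto
    also have "\<dots> = ennreal (?c l) * (\<integral>\<^sup>+w. (\<Sum>R\<in>Bij U. indicator ?E (R, l, w)) \<partial>A s l)"
      by (simp add: sum_distrib_left nn_integral_sum)
    also have "\<dots> \<le> ennreal (?c l) * (\<integral>\<^sup>+w. of_nat K \<partial>A s l)"
    proof (intro mult_left_mono nn_integral_mono)
      fix w :: "response \<times> bool list"
      have "(\<Sum>R\<in>Bij U. indicator ?E (R, l, w))
          = (\<Sum>R\<in>Bij U. if deceiving a b x y R (fst w) then 1 else (0 :: ennreal))"
        by (intro sum.cong) (auto simp: indicator_def case_prod_unfold)
      also have "\<dots> = of_nat (card {R \<in> Bij U. deceiving a b x y R (fst w)})"
        using fin by (simp add: sum.If_cases Int_def)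
      also have "\<dots> \<le> of_nat K"
        unfolding K_def using card_deceiving_le[OF assms(1-5)] by (rule of_nat_mono)
      finally show "(\<Sum>R\<in>Bij U. indicator ?E (R, l, w)) \<le> (of_nat K :: ennreal)" .
    qed auto
    also have "\<dots> = of_nat K * ennreal (?c l)"
      by (simp add: mult.commute)
    finally show ?thesis .
  qed
  have "emeasure (anonymous_round L U A s) ?E
      = (\<integral>\<^sup>+z. indicator ?E z \<partial>measure_pmf (anonymous_round L U A s))"
    by simp
  also have "\<dots> \<le> (\<integral>\<^sup>+l. of_nat K * ennreal (?c l) \<partial>count_space UNIV) / of_nat (card (Bij U))"
    unfolding nn_integral_anonymous_round[OF assms(1)]
    by (intro divide_right_mono_ennreal nn_integral_mono sum_le)
  also have "\<dots> = of_nat K * ((\<integral>\<^sup>+l. ennreal (?c l) \<partial>count_space UNIV) / of_nat (card (Bij U)))"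
    by (simp add: nn_integral_cmult ennreal_times_divide)
  also have "\<dots> \<le> of_nat K * ennreal (1 / fact (card U) * (1 + \<epsilon>))"
    by (intro mult_left_mono sender_anonymous_imp_max_likelihood_le[OF assms(1,6,7)]) auto
  finally show ?thesis
    unfolding K_def .
qed

text \<open>The hypothesis bounds a round conditionally on any state, so each round contributes a
  factor \<open>q\<close> even against an adaptive adversary.\<close>

lemma emeasure_run_rounds_le_power:
  assumes "\<And>s. emeasure (anonymous_round L U A s) {(R, l, v, mem). P R v} \<le> q"
  shows "emeasure (run_rounds L U A m) {(mem, rs). \<forall>(R, v) \<in> set rs. P R v} \<le> q ^ m"
proof (induction m)
  case 0
  show ?case by simp
next
  case (Suc m)
  let ?G = "{(mem, rs). \<forall>(R, v) \<in> set rs. P R v}"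
  let ?D = "{(R, l, v, mem). P R v}"
  \<comment> \<open>All records are good iff the old ones and the new one are, so the indicator
    factorizes.\<close>
  have "emeasure (run_rounds L U A (Suc m)) ?G
      = (\<integral>\<^sup>+s. \<integral>\<^sup>+z. indicator ?G s * indicator ?D z \<partial>anonymous_round L U A s
          \<partial>run_rounds L U A m)"
    by (auto simp: case_prod_unfold indicator_def intro!: nn_integral_cong)
  also have "\<dots> = (\<integral>\<^sup>+s. indicator ?G s * emeasure (anonymous_round L U A s) ?D
          \<partial>run_rounds L U A m)"
    by (simp add: nn_integral_cmult)
  also have "\<dots> \<le> (\<integral>\<^sup>+s. indicator ?G s * q \<partial>run_rounds L U A m)"
    by (intro nn_integral_mono mult_left_mono assms) auto
  also have "\<dots> = emeasure (run_rounds L U A m) ?G * q"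
    by (simp add: nn_integral_multc)
  also have "\<dots> \<le> q ^ m * q"
    by (intro mult_right_mono Suc.IH) auto
  finally show ?case
    by (simp add: mult.commute)
qed

lemma accepted_eq_Some_imp:
  assumes "accepted vs = Some x" "v \<in> set vs"
  shows "v = x"
  using assms by (cases vs) (auto split: if_splits)

theorem theorem2:
  fixes U :: "'u set" and L :: "('u, 'l :: countable) leakage" and A :: "('u, 'l) adversary"
    and N M :: nat and \<epsilon> :: real and alice bob :: 'u and x x' :: "bool list"
  assumes "finite U" and "card U = N"
    and "N \<ge> 2" and "M \<ge> 1" and "\<epsilon> \<ge> 0"
    and "x \<noteq> x'"
    and "alice \<in> U" and "bob \<in> U" and "alice \<noteq> bob"
    and "sender_anonymous L U M \<epsilon>"
    and "is_adversary U A"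
  shows "p_decep L U M A alice bob x x'
    \<le> real (N div 2) ^ M * (real N - real (N div 2)) ^ M / (real N ^ M * (real N - 1) ^ M)
        * (1 + \<epsilon>) ^ M"
proof -
  \<comment> \<open>\<open>K\<close> bounds the number of deceiving bijections for any response
    function, \<open>q\<close> the success probability of one round.\<close>
  define K where "K = (N div 2) * (N - N div 2) * fact (N - 2)"
  define q where "q = real K * (1 / fact N * (1 + \<epsilon>))"
  let ?W = "{(mem, rs). accepted (received alice rs) = Some x \<and> accepted (received bob rs) = Some x'}"
  let ?G = "{(mem, rs). \<forall>(R, v) \<in> set rs. deceiving alice bob x x' R v}"
  have "q \<ge> 0"
    using assms(5) by (simp add: q_def)
  have "of_nat K * ennreal (1 / fact N * (1 + \<epsilon>)) = ennreal q"
    using assms(5) unfolding q_def ennreal_of_nat_eq_real_of_nat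
    by (intro ennreal_mult[symmetric]) auto
  then have round: "emeasure (anonymous_round L U A s) {(R, l, v, mem). deceiving alice bob x x' R v}
      \<le> ennreal q" for s
    using emeasure_anonymous_round_deceiving_le[OF assms(1,7,8,9,6,10,11), of s]
    unfolding assms(2) K_def by argo
  \<comment> \<open>An accepted value equals every response received, so each recorded round is
    deceiving.\<close>
  have "?W \<subseteq> ?G"
    by (force simp: deceiving_def received_def dest: accepted_eq_Some_imp)
  then have "emeasure (run_rounds L U A M) ?W \<le> emeasure (run_rounds L U A M) ?G"
    by (intro emeasure_mono) auto
  also have "\<dots> \<le> ennreal q ^ M"
    by (rule emeasure_run_rounds_le_power[OF round])
  also have "\<dots> = ennreal (q ^ M)"
    using \<open>q \<ge> 0\<close> by (simp add: ennreal_power)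
  finally have "p_decep L U M A alice bob x x' \<le> q ^ M"
    using \<open>q \<ge> 0\<close> by (simp add: p_decep_def measure_pmf.emeasure_eq_measure)
  also have "q = real (N div 2) * (real N - real (N div 2)) / (real N * (real N - 1)) * (1 + \<epsilon>)"
  proof -
    \<comment> \<open>Writing \<open>N\<close> as a double successor unfolds \<open>fact N\<close>
      twice, so that \<open>fact (N - 2)\<close> cancels against the factor in
      \<open>K\<close>.\<close>
    obtain n where n: "N = Suc (Suc n)"
      using assms(3) by (metis Suc_le_D numeral_2_eq_2 Suc_le_mono)
    have "fact N = real N * (real N - 1) * fact (N - 2)"
      by (simp add: n algebra_simps)
    moreover have "real (N - N div 2) = real N - real (N div 2)"
      by (simp add: of_nat_diff)
    ultimately show ?thesis
      unfolding q_def K_def by simp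
  qed
  finally show ?thesis
    by (simp only: power_mult_distrib power_divide)
qed

end
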